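(* (a) A symmetric conjugate form $$f_S(\boldsymbol{x})=\sum_{1\le i_1 \le \dots \le i_d \le n}\, \sum_{1\le j_1 \le \dots \le j_d \le n} a_{i_1\dots i_d,j_1\dots j_d}\,\overline{x_{i_1}\cdots x_{i_d}}\,x_{j_1} \cdots x_{j_d},\qquad \boldsymbol{x}\in\mathbb{C}^n,$$ with complex coefficients, is real-valued (i.e. $f_S(\boldsymbol{x})\in\mathbb{R}$ for all $\boldsymbol{x}\in\mathbb{C}^n$) if and only if $$a_{i_1\dots i_d,j_1\dots j_d}=\overline{a_{j_1\dots j_d,i_1\dots i_d}}, \quad\forall\,1\le i_1\le \dots \le i_d \le n, \ 1\le j_1 \le \dots \le j_d \le n.$$ (b) A general conjugate form $$f_G(\boldsymbol{x})=\sum_{k=0}^d \, \sum_{1\le i_1\le \dots \le i_k \le n}\, \sum_{1\le j_1 \le \dots \le j_{d-k} \le n} a_{i_1\dots i_k,j_1\dots j_{d-k}}\,\overline{x_{i_1}\cdots x_{i_k}}\,x_{j_1} \cdots x_{j_{d-k}},\qquad \boldsymbol{x}\in\mathbb{C}^n,$$ with complex coefficients, is real-valued if and only if $$a_{i_1\dots i_k,j_1\dots j_{d-k}}= \overline{a_{j_1\dots j_{d-k},i_1\dots i_k}}, \quad\forall\,1\le i_1 \le \dots \le i_k \le n, \ 1\le j_1 \le \dots \le j_{d-k} \le n,\ 0\leq k \leq d.$$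
   Context: In the coefficient $a_{i_1\dots i_k,j_1\dots j_{d-k}}$ the comma separates the indices of the conjugated variables (before the comma) from those of the ordinary variables (after the comma); either index list may be empty in (b), and empty products equal $1$. *)

theory Defs
  imports "HOL-Analysis.Analysis"
begin

text \<open>
  Vectors of \<open>\<complex>\<^sup>n\<close> have type \<^typ>\<open>complex ^ 'n\<close>, where \<^typ>\<open>'n\<close> is a finite linearly ordered
  index type in the role of \<open>{1..n}\<close>. A multi-index \<open>i\<^sub>1 \<le> \<dots> \<le> i\<^sub>k\<close> is a sorted list of length \<open>k\<close>.
\<close>

definition multi_indices :: "nat \<Rightarrow> ('n::{finite,linorder}) list set" where
  "multi_indices k = {is. length is = k \<and> sorted is}"

text \<open>The sums below are genuine: a sum over an infinite set would be \<open>0\<close> by convention.\<close>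

lemma finite_multi_indices: "finite (multi_indices k :: ('n::{finite,linorder}) list set)"
proof (rule finite_subset)
  show "(multi_indices k :: 'n list set) \<subseteq> {is. set is \<subseteq> UNIV \<and> length is = k}"
    by (auto simp: multi_indices_def)
  show "finite {is :: 'n list. set is \<subseteq> UNIV \<and> length is = k}"
    by (rule finite_lists_length_eq) simp
qed

definition monomial :: "'n list \<Rightarrow> complex ^ 'n \<Rightarrow> complex" where
  "monomial is x = (\<Prod>i\<leftarrow>is. x $ i)"

text \<open>
  In \<open>a is js\<close> the list \<open>is\<close> indexes the conjugated variables and \<open>js\<close> the ordinary ones. Only the
  values of \<open>a\<close> at the multi-indices that are summed over are coefficients of the form.
\<close>

definition sym_conj_form ::
  "nat \<Rightarrow> ('n list \<Rightarrow> 'n list \<Rightarrow> complex) \<Rightarrow> complex ^ ('n::{finite,linorder}) \<Rightarrow> complex" where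
  "sym_conj_form d a x =
    (\<Sum>is\<in>multi_indices d. \<Sum>js\<in>multi_indices d.
      a is js * cnj (monomial is x) * monomial js x)"

definition gen_conj_form ::
  "nat \<Rightarrow> ('n list \<Rightarrow> 'n list \<Rightarrow> complex) \<Rightarrow> complex ^ ('n::{finite,linorder}) \<Rightarrow> complex" where
  "gen_conj_form d a x =
    (\<Sum>k=0..d. \<Sum>is\<in>multi_indices k. \<Sum>js\<in>multi_indices (d - k).
      a is js * cnj (monomial is x) * monomial js x)"

definition real_valued :: "(complex ^ 'n \<Rightarrow> complex) \<Rightarrow> bool" where
  "real_valued f \<longleftrightarrow> (\<forall>x. f x \<in> \<real>)"

end

theory Submission
  imports Defs
begin

text \<open>
  Let \<open>f\<close> be a conjugate form whose index set of pairs \<open>(I, J)\<close> is invariant under exchanging \<open>I\<close>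
  and \<open>J\<close>; both kinds of form in the theorem are of this shape. Conjugation of \<open>f\<close> exchanges the
  roles of \<open>I\<close> and \<open>J\<close>, so \<open>f - cnj f\<close> is the conjugate form with coefficients
  \<open>a I J - cnj (a J I)\<close>. Everything therefore rests on the linear independence of the functions
  \<open>x \<mapsto> cnj (x\<^sup>I) * x\<^sup>J\<close> (\<open>conj_monomials_independent\<close>).

  For independence it is enough to find a single point \<open>x\<close> at which finitely many of these functions
  take pairwise distinct values \<open>v\<^sub>I\<^sub>J\<close> (\<open>conj_monomials_separated\<close>). At the point with coordinates
  \<open>x\<^sub>i\<^sup>m\<close> they take the values \<open>v\<^sub>I\<^sub>J\<^sup>m\<close>, so a relation \<open>\<Sum> c\<^sub>I\<^sub>J * cnj (x\<^sup>I) * x\<^sup>J = 0\<close> valid at all points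
  gives a Vandermonde system with distinct nodes, and all \<open>c\<^sub>I\<^sub>J\<close> vanish (\<open>power_sums_zero_imp_zero\<close>).

  Such a point is \<open>x\<^sub>i = p\<^sub>i\<^bsup>1 + \<i>\<theta>\<^esup>\<close> with distinct primes \<open>p\<^sub>i\<close> and a small \<open>\<theta> > 0\<close>. Writing \<open>p\<^sub>I\<close> for the
  product of the \<open>p\<^sub>i\<close> with \<open>i\<close> in \<open>I\<close>, the value of the function at \<open>x\<close> has modulus \<open>p\<^sub>I * p\<^sub>J\<close>
  and argument \<open>\<theta> * ln (p\<^sub>J / p\<^sub>I)\<close>. As \<open>\<theta>\<close> is small, the argument causes no ambiguity modulo
  \<open>2 * \<pi>\<close>, so the value determines \<open>p\<^sub>I\<close> and \<open>p\<^sub>J\<close>, and unique factorisation recovers \<open>I\<close> and \<open>J\<close>.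
\<close>

section \<open>Separating multi-indices by primes\<close>

lemma ex_inj_primes:
  "\<exists>p :: 'n::finite \<Rightarrow> nat. inj p \<and> (\<forall>i. prime (p i))"
proof -
  obtain e :: "'n \<Rightarrow> nat" where e: "inj e"
    using finite_imp_inj_to_nat_seg[of "UNIV :: 'n set"] by auto
  define p where "p = (\<lambda>i. enumerate {q::nat. prime q} (e i))"
  have "inj p"
    using e strict_mono_enumerate[OF primes_infinite, THEN strict_mono_imp_inj_on]
    unfolding p_def inj_def by (metis UNIV_I inj_onD)
  moreover have "prime (p i)" for i
    using enumerate_in_set[OF primes_infinite] by (auto simp: p_def)
  ultimately show ?thesis by blast
qed

text \<open>A sorted list is determined by its multiset, and that by unique factorisation.\<close>

lemma sorted_eq_of_prime_products:
  fixes p :: "'n::linorder \<Rightarrow> nat"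
  assumes "inj p" and "\<And>i. prime (p i)" and "sorted I" and "sorted J"
    and eq: "prod_list (map p I) = prod_list (map p J)"
  shows "I = J"
proof -
  have fact: "prime_factorization (prod_list (map p K)) = image_mset p (mset K)" for K
  proof -
    have "prime_factorization (\<Prod>\<^sub># (image_mset p (mset K))) = image_mset p (mset K)"
      by (rule prime_factorization_prod_mset_primes) (use assms(2) in auto)
    then show ?thesis by (simp flip: prod_mset_prod_list)
  qed
  have "image_mset p (mset I) = image_mset p (mset J)"
    using fact[of I] fact[of J] eq by simp
  then have "image_mset (inv p) (image_mset p (mset I)) = image_mset (inv p) (image_mset p (mset J))"
    by (rule arg_cong)
  then have "mset I = mset J"
    using \<open>inj p\<close> by (simp add: multiset.map_comp)
  then show ?thesis
    using properties_for_sort[of J I] properties_for_sort[of I I] assms(3,4) by simp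
qed

lemma monomial_exp:
  "monomial I (\<chi> i. exp (w * complex_of_real (ln (real (p i)))))
    = exp (w * complex_of_real (ln (real (prod_list (map p I)))))"
  if "\<And>i. p i > 0"
proof (induction I)
  case Nil
  then show ?case by (simp add: monomial_def)
next
  case (Cons i I)
  have "prod_list (map p I) > 0"
    using that by (induction I) auto
  then show ?case
    using Cons that[of i]
    by (simp add: monomial_def ln_mult distrib_left exp_add)
qed

text \<open>
  With \<open>L K = ln p\<^sub>K\<close>, conjugating \<open>x\<^sup>I\<close> makes the value at \<open>x\<close> the exponential of
  \<open>(L I + L J) + \<i>\<theta> (L J - L I)\<close>. The sum and the difference of \<open>L I\<close> and \<open>L J\<close> are read off
  separately from the real and the imaginary part. With real \<open>x\<close> only the sum would be visible, so
  \<open>(I, J)\<close> could not be told from \<open>(J, I)\<close>.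
\<close>

lemma conj_monomials_separated:
  fixes P :: "(('n::{finite,linorder}) list \<times> 'n list) set"
  assumes fin: "finite P" and sorted: "\<And>I J. (I, J) \<in> P \<Longrightarrow> sorted I \<and> sorted J"
  shows "\<exists>x. inj_on (\<lambda>(I, J). cnj (monomial I x) * monomial J x) P"
proof -
  obtain p :: "'n \<Rightarrow> nat" where p: "inj p" "\<And>i. prime (p i)"
    using ex_inj_primes by blast
  have p0: "p i > 0" for i
    using p(2) prime_gt_0_nat by blast
  define L where "L = (\<lambda>I. ln (real (prod_list (map p I))))"
  have L_inj: "I = J" if "L I = L J" "sorted I" "sorted J" for I J
  proof -
    have "prod_list (map p K) > 0" for K
      using p0 by (induction K) auto
    then have "prod_list (map p I) = prod_list (map p J)"
      using that(1) by (simp add: L_def)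
    then show ?thesis
      using sorted_eq_of_prime_products p that by blast
  qed
  define D where "D = (\<lambda>(I, J). L J - L I)"
  define B where "B = (\<Sum>q\<in>P. \<bar>D q\<bar>)"
  have B: "\<bar>D q\<bar> \<le> B" if "q \<in> P" for q
    unfolding B_def by (rule member_le_sum) (use that fin in auto)
  have B0: "B \<ge> 0"
    unfolding B_def by (simp add: sum_nonneg)
  \<comment> \<open>Small enough that all the imaginary parts lie in the strip where \<open>exp\<close> is injective; the \<open>1\<close>
    keeps the denominator positive when all differences vanish.\<close>
  define \<theta> where "\<theta> = 1 / (B + 1)"
  have \<theta>: "\<theta> > 0" using B0 by (simp add: \<theta>_def)
  have arg: "\<bar>\<theta> * D q\<bar> < pi" if "q \<in> P" for q
  proof -
    have "\<bar>\<theta> * D q\<bar> \<le> \<theta> * B"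
      using B[OF that] \<theta> by (simp add: abs_mult)
    also have "\<dots> \<le> 1" using B0 by (simp add: \<theta>_def)
    also have "\<dots> < pi" using pi_gt3 by simp
    finally show ?thesis .
  qed
  define w where "w = Complex 1 \<theta>"
  define x :: "complex ^ ('n::{finite,linorder})" where "x = (\<chi> i. exp (w * complex_of_real (ln (real (p i)))))"
  have val: "cnj (monomial I x) * monomial J x = exp (Complex (L I + L J) (\<theta> * D (I, J)))" for I J
  proof -
    have m: "monomial K x = exp (w * complex_of_real (L K))" for K
      unfolding x_def L_def by (rule monomial_exp) (rule p0)
    have "cnj w * complex_of_real (L I) + w * complex_of_real (L J)
        = Complex (L I + L J) (\<theta> * D (I, J))"
      by (simp add: complex_eq_iff w_def D_def algebra_simps)
    then show ?thesis
      by (simp add: m exp_cnj flip: exp_add)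
  qed
  have "inj_on (\<lambda>(I, J). cnj (monomial I x) * monomial J x) P"
  proof (rule inj_onI, clarify)
    fix I J I' J'
    assume q: "(I, J) \<in> P" "(I', J') \<in> P"
      and "cnj (monomial I x) * monomial J x = cnj (monomial I' x) * monomial J' x"
    then have "exp (Complex (L I + L J) (\<theta> * D (I, J))) = exp (Complex (L I' + L J') (\<theta> * D (I', J')))"
      by (simp only: val)
    moreover have "\<bar>\<theta> * D (I, J) - \<theta> * D (I', J')\<bar> < 2 * pi"
      using arg[OF q(1)] arg[OF q(2)] by linarith
    ultimately have "Complex (L I + L J) (\<theta> * D (I, J)) = Complex (L I' + L J') (\<theta> * D (I', J'))"
      by (metis exp_complex_eqI complex.sel(2))
    then have "L I + L J = L I' + L J'" and "L J - L I = L J' - L I'"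
      using \<theta> by (simp_all add: D_def)
    then have "L I = L I'" and "L J = L J'"
      by simp_all
    then show "I = I' \<and> J = J'"
      using L_inj sorted q by blast
  qed
  then show ?thesis ..
qed

section \<open>Linear independence\<close>

text \<open>
  The Vandermonde matrix of distinct nodes is nonsingular. The hypothesis extends linearly from powers to all polynomials; evaluating it at the polynomial
  that vanishes at every node but one isolates a single coefficient.
\<close>

lemma power_sums_zero_imp_zero:
  fixes c v :: "'a \<Rightarrow> complex"
  assumes fin: "finite P" and inj: "inj_on v P"
    and zero: "\<And>m::nat. (\<Sum>q\<in>P. c q * v q ^ m) = 0" and "r \<in> P"
  shows "c r = 0"
proof -
  have poly0: "(\<Sum>q\<in>P. c q * poly g (v q)) = 0" for g
  proof -
    have "(\<Sum>q\<in>P. c q * poly g (v q))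
        = (\<Sum>m\<le>degree g. coeff g m * (\<Sum>q\<in>P. c q * v q ^ m))"
      by (subst sum_distrib_left, subst sum.swap)
        (simp add: poly_altdef sum_distrib_left mult_ac)
    then show ?thesis by (simp add: zero)
  qed
  define g where "g = (\<Prod>s\<in>P - {r}. [:- v s, 1:])"
  have "poly g (v q) = 0" if "q \<in> P" "q \<noteq> r" for q
    using that fin by (auto simp: g_def poly_prod intro: prod_zero)
  then have "(\<Sum>q\<in>P - {r}. c q * poly g (v q)) = 0"
    by (intro sum.neutral) auto
  then have "c r * poly g (v r) = 0"
    using poly0[of g] sum.remove[OF fin \<open>r \<in> P\<close>, of "\<lambda>q. c q * poly g (v q)"] by simp
  moreover have "poly g (v r) \<noteq> 0"
    using fin inj \<open>r \<in> P\<close> by (auto simp: g_def poly_prod inj_on_def)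
  ultimately show ?thesis by simp
qed

text \<open>This is what turns one separating point into a whole sequence of evaluation points.\<close>

lemma monomial_power: "monomial I (\<chi> i. x $ i ^ m) = monomial I x ^ m"
  by (induction I) (simp_all add: monomial_def power_mult_distrib)

lemma conj_monomials_independent:
  fixes P :: "(('n::{finite,linorder}) list \<times> 'n list) set"
  assumes fin: "finite P" and sorted: "\<And>I J. (I, J) \<in> P \<Longrightarrow> sorted I \<and> sorted J"
    and zero: "\<And>x. (\<Sum>(I, J)\<in>P. c I J * (cnj (monomial I x) * monomial J x)) = 0"
    and "(I, J) \<in> P"
  shows "c I J = 0"
proof -
  define v :: "complex ^ ('n::{finite,linorder}) \<Rightarrow> 'n list \<times> 'n list \<Rightarrow> complex"
    where "v = (\<lambda>x (I, J). cnj (monomial I x) * monomial J x)"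
  obtain x where x: "inj_on (v x) P"
    using conj_monomials_separated[OF fin sorted] unfolding v_def by blast
  have "(\<Sum>q\<in>P. case_prod c q * v x q ^ m) = 0" for m
    using zero[of "\<chi> i. x $ i ^ m"]
    by (simp add: v_def monomial_power power_mult_distrib case_prod_unfold)
  from power_sums_zero_imp_zero[OF fin x this \<open>(I, J) \<in> P\<close>] show ?thesis
    by simp
qed

section \<open>Real-valued conjugate forms\<close>

text \<open>
  The invariance of \<open>P\<close> under exchange makes the conjugate of the form a form over the same \<open>P\<close>, so
  that coefficients can be compared. The sum over \<open>P\<close> covers both kinds of form: for the symmetric
  one \<open>P\<close> fixes both lengths, for the general one only their sum.
\<close>

lemma real_valued_conj_form_iff:
  fixes P :: "(('n::{finite,linorder}) list \<times> 'n list) set"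
  assumes fin: "finite P" and sorted: "\<And>I J. (I, J) \<in> P \<Longrightarrow> sorted I \<and> sorted J"
    and swap: "\<And>I J. (I, J) \<in> P \<Longrightarrow> (J, I) \<in> P"
  shows "real_valued (\<lambda>x. \<Sum>(I, J)\<in>P. a I J * cnj (monomial I x) * monomial J x)
    \<longleftrightarrow> (\<forall>(I, J)\<in>P. a I J = cnj (a J I))" (is "real_valued ?f \<longleftrightarrow> ?sym")
proof -
  define c where "c = (\<lambda>I J. a I J - cnj (a J I))"
  have diff: "?f x - cnj (?f x) = (\<Sum>(I, J)\<in>P. c I J * (cnj (monomial I x) * monomial J x))" for x
  proof -
    have "cnj (?f x) = (\<Sum>(I, J)\<in>P. cnj (a I J) * monomial I x * cnj (monomial J x))"
      by (simp add: case_prod_unfold)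
    also have "\<dots> = (\<Sum>(I, J)\<in>P. cnj (a J I) * monomial J x * cnj (monomial I x))"
      by (rule sum.reindex_bij_witness[of _ prod.swap prod.swap]) (auto intro: swap)
    finally show ?thesis
      by (simp add: c_def case_prod_unfold sum_subtractf[symmetric] algebra_simps)
  qed
  have "real_valued ?f \<longleftrightarrow>
      (\<forall>x. (\<Sum>(I, J)\<in>P. c I J * (cnj (monomial I x) * monomial J x)) = 0)"
    unfolding real_valued_def Reals_cnj_iff diff[symmetric] by auto
  also have "\<dots> \<longleftrightarrow> (\<forall>(I, J)\<in>P. c I J = 0)"
  proof
    assume "\<forall>x. (\<Sum>(I, J)\<in>P. c I J * (cnj (monomial I x) * monomial J x)) = 0"
    then show "\<forall>(I, J)\<in>P. c I J = 0"
      using conj_monomials_independent[OF fin sorted, of c] by blast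
  next
    assume "\<forall>(I, J)\<in>P. c I J = 0"
    then show "\<forall>x. (\<Sum>(I, J)\<in>P. c I J * (cnj (monomial I x) * monomial J x)) = 0"
      by (auto intro!: sum.neutral)
  qed
  also have "\<dots> \<longleftrightarrow> ?sym"
    by (simp add: c_def)
  finally show ?thesis .
qed

lemma real_valued_sym_conj_form_iff:
  fixes a :: "('n::{finite,linorder}) list \<Rightarrow> 'n list \<Rightarrow> complex"
  shows "real_valued (sym_conj_form d a) \<longleftrightarrow>
    (\<forall>is\<in>multi_indices d. \<forall>js\<in>multi_indices d. a is js = cnj (a js is))"
proof -
  define P where "P = (multi_indices d \<times> multi_indices d :: ('n list \<times> 'n list) set)"
  have form: "sym_conj_form d a = (\<lambda>x. \<Sum>(I, J)\<in>P. a I J * cnj (monomial I x) * monomial J x)"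
    by (simp add: fun_eq_iff sym_conj_form_def P_def sum.cartesian_product)
  have "real_valued (sym_conj_form d a) \<longleftrightarrow> (\<forall>(I, J)\<in>P. a I J = cnj (a J I))"
    unfolding form
    by (rule real_valued_conj_form_iff)
      (auto simp: P_def finite_multi_indices, auto simp: multi_indices_def)
  then show ?thesis
    by (simp add: P_def)
qed

lemma real_valued_gen_conj_form_iff:
  fixes b :: "('n::{finite,linorder}) list \<Rightarrow> 'n list \<Rightarrow> complex"
  shows "real_valued (gen_conj_form d b) \<longleftrightarrow>
    (\<forall>k\<in>{0..d}. \<forall>is\<in>multi_indices k. \<forall>js\<in>multi_indices (d - k). b is js = cnj (b js is))"
proof -
  define S where "S = (\<lambda>k. multi_indices k \<times> multi_indices (d - k) :: ('n list \<times> 'n list) set)"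
  define P where "P = (\<Union>k\<in>{0..d}. S k)"
  have "(\<Sum>(I, J)\<in>P. t I J) = (\<Sum>k=0..d. \<Sum>(I, J)\<in>S k. t I J)"
    for t :: "'n list \<Rightarrow> 'n list \<Rightarrow> complex"
    unfolding P_def
    by (rule sum.UNION_disjoint)
      (auto simp: S_def finite_multi_indices, auto simp: multi_indices_def)
  then have form:
    "gen_conj_form d b = (\<lambda>x. \<Sum>(I, J)\<in>P. b I J * cnj (monomial I x) * monomial J x)"
    by (simp add: fun_eq_iff gen_conj_form_def S_def sum.cartesian_product)
  have P_iff: "(I, J) \<in> P \<longleftrightarrow> sorted I \<and> sorted J \<and> length I + length J = d" for I J
    by (auto simp: P_def S_def multi_indices_def)
  have "real_valued (gen_conj_form d b) \<longleftrightarrow> (\<forall>(I, J)\<in>P. b I J = cnj (b J I))"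
    unfolding form
  proof (rule real_valued_conj_form_iff)
    show "finite P"
      by (simp add: P_def S_def finite_multi_indices)
  qed (auto simp: P_iff)
  then show ?thesis
    by (simp add: P_def S_def)
qed

theorem corollary3p2:
  fixes d :: nat
    and a b :: "('n::{finite,linorder}) list \<Rightarrow> 'n list \<Rightarrow> complex"
  shows "(real_valued (sym_conj_form d a) \<longleftrightarrow>
           (\<forall>is\<in>multi_indices d. \<forall>js\<in>multi_indices d. a is js = cnj (a js is)))
       \<and> (real_valued (gen_conj_form d b) \<longleftrightarrow>
           (\<forall>k\<in>{0..d}. \<forall>is\<in>multi_indices k. \<forall>js\<in>multi_indices (d - k). b is js = cnj (b js is)))"
  using real_valued_sym_conj_form_iff real_valued_gen_conj_form_iff by blast

end
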